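(* Let $q,a$ be complex numbers with $|q|<1$ and $aq^{i}\neq 1$ for all integers $i\ge 0$. Then $$\sum_{r=0}^\infty \sum_{s=0}^\infty \sum_{t=0}^\infty \frac{a^{r+2s+3t}\, q^{3(r+s+t)^2 + 3(s+t)^2 + 3t^2}}{(q^3;q^3)_r\, (q^3;q^3)_s\, (q^3;q^3)_t} =\frac{(aq;q)_\infty}{(aq^3;q^3)_\infty}\sum_{j=0}^\infty \frac{a^j q^{j^2}\, (a;q^3)_j}{(a;q)_{2j}\, (q;q)_j}.$$
   Context: For complex $A$ and base $p$ with $|p|<1$: $(A;p)_m=\prod_{i=0}^{m-1}(1-Ap^i)$ for integers $m\ge0$ (so $(A;p)_0=1$), and $(A;p)_\infty=\prod_{i=0}^{\infty}(1-Ap^i)$. *)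

theory Defs
  imports "HOL-Analysis.Analysis"
begin

definition qpoch :: "complex \<Rightarrow> complex \<Rightarrow> nat \<Rightarrow> complex"
  where "qpoch A p m = (\<Prod>i<m. 1 - A * p ^ i)"

definition qpoch_inf :: "complex \<Rightarrow> complex \<Rightarrow> complex"
  where "qpoch_inf A p = (\<Prod>i. 1 - A * p ^ i)"

text \<open>For \<open>norm p < 1\<close> the product defining \<open>qpoch_inf\<close> converges (vanishing factors allowed)
  and is the limit of the finite products, so no default value of \<open>prodinf\<close> is involved.\<close>

lemma convergent_prod_qpoch_inf:
  fixes A p :: complex
  assumes "norm p < 1"
  shows "convergent_prod (\<lambda>i. 1 - A * p ^ i)"
proof -
  have "summable (\<lambda>i. norm A * norm p ^ i)"
    using assms by (intro summable_mult summable_geometric) simp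
  hence "abs_convergent_prod (\<lambda>i. 1 - A * p ^ i)"
    by (intro summable_imp_abs_convergent_prod) (simp add: norm_mult norm_power)
  thus ?thesis
    by (rule abs_convergent_prod_imp_convergent_prod)
qed

lemma qpoch_tendsto_qpoch_inf:
  fixes A p :: complex
  assumes "norm p < 1"
  shows "qpoch A p \<longlonglongrightarrow> qpoch_inf A p"
proof -
  have "(\<lambda>n. qpoch A p (Suc n)) \<longlonglongrightarrow> qpoch_inf A p"
    using convergent_prod_LIMSEQ[OF convergent_prod_qpoch_inf[OF assms, of A]]
    by (simp add: qpoch_def qpoch_inf_def lessThan_Suc_atMost)
  thus ?thesis
    by (simp only: filterlim_sequentially_Suc)
qed

end

theory Submission
  imports Defs
begin

text \<open>
  Both sides come from Bailey pairs relative to \<open>a\<close> via the limiting Bailey lemma. Put \<open>Q = q\<^sup>3\<close>. Three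
  Bailey steps applied to the unit pair in base \<open>Q\<close> turn \<open>\<beta>\<close> into a double sum, and the limit of a
  fourth step gives the triple sum as \<open>1 / (a Q; Q)\<^sub>\<infinity>\<close> times \<open>\<Sum>\<^sub>r a^(4r) Q^(4r^2) \<alpha>\<^sub>r\<close>, with \<open>\<alpha>\<close> the
  unit sequence in base \<open>Q\<close>. In base \<open>q\<close>, the sequence \<open>\<beta>\<^sub>n = (a; Q)\<^sub>n / ((a; q)\<^bsub>2n\<^esub> (q; q)\<^sub>n)\<close> belongs to
  a pair whose \<open>\<alpha>\<close> is supported on multiples of 3 and equals \<open>a\<^sup>r Q^(r^2) \<alpha>\<^sub>r\<close> at \<open>3r\<close>. One limiting step
  then yields the same single sum divided by \<open>(a q; q)\<^sub>\<infinity>\<close>.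
\<close>


text \<open>Extending \<open>1 / (q; q)\<^sub>m\<close> by 0 to negative \<open>m\<close> keeps its recurrence valid for every integer \<open>m\<close>,
  so the telescoping sums below have no boundary terms.\<close>

definition inv_qq :: "complex \<Rightarrow> int \<Rightarrow> complex"
  where "inv_qq q m = (if m < 0 then 0 else 1 / qpoch q q (nat m))"

definition bailey_pair :: "complex \<Rightarrow> complex \<Rightarrow> (nat \<Rightarrow> complex) \<Rightarrow> (nat \<Rightarrow> complex) \<Rightarrow> bool"
  where "bailey_pair a q \<alpha> \<beta> \<longleftrightarrow>
    (\<forall>n. \<beta> n = (\<Sum>r\<le>n. \<alpha> r / (qpoch q q (n - r) * qpoch (a * q) q (n + r))))"

text \<open>The sequence paired with the unit \<open>\<beta>\<close>;
  \<open>(1 - a * q ^ (2 * r)) / (1 - a)\<close> is its very-well-poised factor. The division by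
  \<open>1 - a\<close> is genuine wherever \<open>a * q ^ i \<noteq> 1\<close> is assumed, by the
  case \<open>i = 0\<close>.\<close>

definition unit_alpha :: "complex \<Rightarrow> complex \<Rightarrow> nat \<Rightarrow> complex"
  where "unit_alpha a q r =
    (-1) ^ r * q ^ (r choose 2) * (1 - a * q ^ (2 * r)) * qpoch a q r / ((1 - a) * qpoch q q r)"

section \<open>Finite q-shifted factorials\<close>

lemma qpoch_0 [simp]: "qpoch A p 0 = 1"
  by (simp add: qpoch_def)

lemma qpoch_Suc: "qpoch A p (Suc n) = qpoch A p n * (1 - A * p ^ n)"
  by (simp add: qpoch_def)

lemma qpoch_add: "qpoch A p (m + n) = qpoch A p m * qpoch (A * p ^ m) p n"
  by (induction n) (simp_all add: qpoch_Suc power_add mult.assoc)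

lemma qpoch_nonzero:
  assumes "\<And>i. A * p ^ i \<noteq> 1"
  shows "qpoch A p n \<noteq> 0"
  using assms by (auto simp: qpoch_def)

lemma power_Suc_neq_1:
  fixes q :: complex
  assumes "norm q < 1"
  shows "q * q ^ i \<noteq> 1"
proof
  assume "q * q ^ i = 1"
  hence "norm q ^ Suc i = 1" by (metis norm_one norm_power power_Suc)
  moreover have "norm q ^ Suc i < 1"
    using power_le_one[of "norm q" i] assms
    by (metis mult_left_le norm_ge_zero order_le_less_trans power_Suc less_imp_le)
  ultimately show False by simp
qed

lemma qpoch_qq_nonzero: "norm q < 1 \<Longrightarrow> qpoch q q n \<noteq> 0"
  by (intro qpoch_nonzero power_Suc_neq_1)

lemma inv_qq_of_nat: "m \<le> n \<Longrightarrow> inv_qq q (int n - int m) = 1 / qpoch q q (n - m)"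
  by (simp add: inv_qq_def nat_diff_distrib)

text \<open>For negative \<open>m\<close> both sides are 0, at \<open>m = 0\<close> the factor
  \<open>1 - q powi 0\<close> vanishes, and for positive \<open>m\<close> this is the product
  recurrence.\<close>

lemma inv_qq_diff_1:
  assumes "norm q < 1"
  shows "inv_qq q (m - 1) = (1 - q powi m) * inv_qq q m"
proof (cases "m \<le> 0")
  case True
  thus ?thesis by (cases "m = 0") (auto simp: inv_qq_def)
next
  case False
  then obtain k where k: "m = 1 + int k" by (metis zero_less_imp_eq_int not_le add.commute
        of_nat_Suc Suc_pred' of_nat_0_less_iff)
  have "nat (1 + int k) = Suc k" by simp
  moreover have "q powi m = q ^ Suc k" unfolding k
    by (metis power_int_of_nat of_nat_Suc)
  ultimately show ?thesis using qpoch_qq_nonzero[OF assms, of "Suc k"]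
    unfolding k by (auto simp: inv_qq_def qpoch_Suc)
qed

section \<open>A finite q-Vandermonde sum and Bailey's lemma\<close>

text \<open>Termwise recurrence in \<open>M\<close>: the right side is the forward difference in
  \<open>i\<close> of \<open>- A * q ^ (Suc M + i) * f M i\<close>, so summation over
  \<open>i\<close> telescopes.\<close>

lemma q_vandermonde_aux:
  assumes "norm q < 1" "q \<noteq> 0" "\<And>i. A * q ^ Suc i \<noteq> 1"
  defines "f \<equiv> (\<lambda>M j. A ^ j * q ^ (j\<^sup>2) * inv_qq q (int M - int j)
                   / (qpoch q q j * qpoch (A * q) q j))"
  shows "(1 - q ^ Suc M) * (1 - A * q ^ Suc M) * f (Suc M) (Suc i) - f M (Suc i)
       = - A * q ^ (Suc M + Suc i) * f M (Suc i) + A * q ^ (Suc M + i) * f M i"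
proof -
  \<comment> \<open>All three values of \<open>f\<close> are \<open>c\<close> times a rational
    function of \<open>x\<close>, \<open>N\<close>, \<open>q\<close> and \<open>A\<close>, so only a
    rational identity remains.\<close>
  define x N U c where "x = q ^ i" and "N = q ^ Suc M" and "U = inv_qq q (int M - int i)"
    and "c = A ^ i * q ^ (i\<^sup>2) * U / (qpoch q q i * qpoch (A * q) q i)"
  have x: "x \<noteq> 0" "1 - q * x \<noteq> 0" "1 - A * q * x \<noteq> 0"
    using assms(2) power_Suc_neq_1[OF assms(1), of i] assms(3)[of i]
    by (auto simp: x_def mult.assoc)
  have "inv_qq q (int M - int (Suc i)) = inv_qq q ((int M - int i) - 1)"
    by (simp add: algebra_simps)
  also have "\<dots> = (1 - q powi (int M - int i)) * U"
    by (subst inv_qq_diff_1[OF assms(1)]) (simp add: U_def)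
  also have "q powi (int M - int i) = N / (q * x)"
    using assms(2) by (simp add: power_int_diff x_def N_def)
  finally have U: "inv_qq q (int M - int (Suc i)) = (1 - N / (q * x)) * U" .
  have sq: "q ^ ((Suc i)\<^sup>2) = q ^ (i\<^sup>2) * x\<^sup>2 * q"
    by (simp add: power2_eq_square x_def power_add)
  have f1: "f M i = c" by (simp add: f_def c_def U_def)
  have f2: "f (Suc M) (Suc i) = c * A * q * x\<^sup>2 / ((1 - q * x) * (1 - A * q * x))"
    by (simp add: f_def c_def sq qpoch_Suc U_def mult_ac flip: x_def)
  have f3: "f M (Suc i) = c * A * q * x\<^sup>2 * (1 - N / (q * x)) / ((1 - q * x) * (1 - A * q * x))"
    unfolding f_def U by (simp add: c_def sq qpoch_Suc mult_ac flip: x_def)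
  have "q ^ (Suc M + Suc i) = N * q * x" "q ^ (Suc M + i) = N * x"
    by (simp_all add: N_def x_def power_add)
  thus ?thesis
    unfolding f1 f2 f3 N_def[symmetric] using x assms(2)
    by (simp add: divide_simps) (simp add: algebra_simps power2_eq_square)
qed

text \<open>The q-Chu-Vandermonde sum with its free numerator parameter sent to infinity, by
  induction on \<open>M\<close> through the telescoping recurrence.\<close>

lemma q_vandermonde:
  assumes "norm q < 1" "q \<noteq> 0" "\<And>i. A * q ^ Suc i \<noteq> 1"
  shows "(\<Sum>j\<le>M. A ^ j * q ^ (j\<^sup>2) / (qpoch q q (M - j) * qpoch q q j * qpoch (A * q) q j))
       = 1 / (qpoch q q M * qpoch (A * q) q M)"
proof -
  define f where "f = (\<lambda>M j. A ^ j * q ^ (j\<^sup>2) * inv_qq q (int M - int j)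
                   / (qpoch q q j * qpoch (A * q) q j))"
  have nz: "1 - q ^ Suc M \<noteq> 0" "1 - A * q ^ Suc M \<noteq> 0" for M
    using assms(3)[of M] power_Suc_neq_1[OF assms(1), of M] by auto
  have "(\<Sum>j\<le>M. f M j) = 1 / (qpoch q q M * qpoch (A * q) q M)"
  proof (induction M)
    case 0
    thus ?case by (simp add: f_def inv_qq_def)
  next
    case (Suc M)
    define K where "K = (1 - q ^ Suc M) * (1 - A * q ^ Suc M)"
    have K: "K \<noteq> 0" using nz[of M] by (simp add: K_def)
    have rec: "K * f (Suc M) (Suc i) - f M (Suc i)
        = A * q ^ (Suc M + i) * f M i - A * q ^ (Suc M + Suc i) * f M (Suc i)" for i
      using q_vandermonde_aux[OF assms, of M i] by (simp add: f_def K_def)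
    have "inv_qq q (int M) = (1 - q ^ Suc M) * inv_qq q (1 + int M)"
      using inv_qq_diff_1[OF assms(1), of "1 + int M"]
      by (metis add_diff_cancel_left' power_int_of_nat of_nat_Suc)
    hence "f M 0 = (1 - q ^ Suc M) * f (Suc M) 0"
      by (simp add: f_def)
    hence base: "K * f (Suc M) 0 - f M 0 = - A * q ^ Suc M * f M 0"
      by (simp only: K_def) (simp add: algebra_simps)
    have tel: "(\<Sum>j\<le>n. K * f (Suc M) j - f M j) = - A * q ^ (Suc M + n) * f M n" for n
      by (induction n) (use base rec in \<open>simp_all add: algebra_simps\<close>)
    \<comment> \<open>This removes the upper boundary term and lets the sums for \<open>M\<close>
      and \<open>Suc M\<close> share one range.\<close>
    have z: "f M (Suc M) = 0" by (simp add: f_def inv_qq_def)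
    have "(\<Sum>j\<le>Suc M. K * f (Suc M) j - f M j) = 0"
      by (subst tel) (simp add: z)
    hence "K * (\<Sum>j\<le>Suc M. f (Suc M) j) = (\<Sum>j\<le>M. f M j)"
      unfolding sum_subtractf sum_distrib_left[symmetric] sum.atMost_Suc[of "f M"] z by simp
    hence "(\<Sum>j\<le>Suc M. f (Suc M) j) = 1 / (qpoch q q M * qpoch (A * q) q M) / K"
      using K unfolding Suc.IH by (metis nonzero_mult_div_cancel_left)
    thus ?case
      by (simp add: K_def qpoch_Suc mult_ac)
  qed
  moreover have "(\<Sum>j\<le>M. f M j) =
    (\<Sum>j\<le>M. A ^ j * q ^ (j\<^sup>2) / (qpoch q q (M - j) * qpoch q q j * qpoch (A * q) q j))"
    by (intro sum.cong) (auto simp: f_def inv_qq_of_nat)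
  ultimately show ?thesis by simp
qed

text \<open>Bailey's lemma with both free parameters sent to infinity. After the sums are exchanged,
  the inner sum over \<open>j = k - r\<close> is \<open>q_vandermonde\<close> with
  \<open>A = a * q ^ (2 * r)\<close>.\<close>

lemma bailey_lemma:
  assumes q: "norm q < 1" "q \<noteq> 0" and a: "\<And>i. a * q ^ i \<noteq> 1"
    and pair: "bailey_pair a q \<alpha> \<beta>"
  shows "bailey_pair a q (\<lambda>r. a ^ r * q ^ (r\<^sup>2) * \<alpha> r)
           (\<lambda>n. \<Sum>k\<le>n. a ^ k * q ^ (k\<^sup>2) * \<beta> k / qpoch q q (n - k))"
  unfolding bailey_pair_def
proof
  fix n
  let ?g = "\<lambda>k r. a ^ k * q ^ (k\<^sup>2) * (\<alpha> r / (qpoch q q (k - r) * qpoch (a * q) q (k + r)))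
                      / qpoch q q (n - k)"
  have "(\<Sum>k\<le>n. a ^ k * q ^ (k\<^sup>2) * \<beta> k / qpoch q q (n - k)) = (\<Sum>k\<le>n. \<Sum>r\<le>k. ?g k r)"
    using pair unfolding bailey_pair_def by (simp add: sum_distrib_left sum_divide_distrib)
  also have "\<dots> = (\<Sum>r\<le>n. \<Sum>j\<le>n - r. ?g (r + j) r)"
    unfolding sum.Sigma[OF finite_atMost ballI[OF finite_atMost]]
    by (rule sum.reindex_bij_witness[where i = "\<lambda>(r, j). (r + j, r)" and j = "\<lambda>(k, r). (r, k - r)"])
       auto
  also have "\<dots> = (\<Sum>r\<le>n. a ^ r * q ^ (r\<^sup>2) * \<alpha> r / (qpoch q q (n - r) * qpoch (a * q) q (n + r)))"
  proof (intro sum.cong refl)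
    fix r assume "r \<in> {..n}"
    hence r: "r \<le> n" by simp
    \<comment> \<open>The parameter left after the first \<open>2 * r\<close> factors are split off
      from \<open>qpoch (a * q) q (2 * r + j)\<close>.\<close>
    define A where "A = a * q ^ (2 * r)"
    have A: "A * q ^ Suc i \<noteq> 1" for i
      using a[of "2 * r + Suc i"] by (simp only: A_def power_add mult.assoc not_False_eq_True)
    have poch: "qpoch (a * q) q (2 * r + j) = qpoch (a * q) q (2 * r) * qpoch (A * q) q j" for j
      by (simp add: qpoch_add A_def mult_ac)
    have "(\<Sum>j\<le>n - r. ?g (r + j) r) = (\<Sum>j\<le>n - r. a ^ r * q ^ (r\<^sup>2) * \<alpha> r / qpoch (a * q) q (2 * r)
       * (A ^ j * q ^ (j\<^sup>2) / (qpoch q q (n - r - j) * qpoch q q j * qpoch (A * q) q j)))"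
    proof (intro sum.cong refl)
      fix j
      have e: "(r + j) + r = 2 * r + j" by simp
      have "a ^ (r + j) * q ^ ((r + j)\<^sup>2) = a ^ r * q ^ (r\<^sup>2) * (A ^ j * q ^ (j\<^sup>2))"
        by (simp add: A_def power_add power_mult_distrib power2_sum algebra_simps flip: power_mult)
      thus "?g (r + j) r = a ^ r * q ^ (r\<^sup>2) * \<alpha> r / qpoch (a * q) q (2 * r)
       * (A ^ j * q ^ (j\<^sup>2) / (qpoch q q (n - r - j) * qpoch q q j * qpoch (A * q) q j))"
        unfolding e poch by (simp add: mult_ac)
    qed
    also have "\<dots> = a ^ r * q ^ (r\<^sup>2) * \<alpha> r / qpoch (a * q) q (2 * r)
        * (1 / (qpoch q q (n - r) * qpoch (A * q) q (n - r)))"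
      by (simp only: sum_distrib_left[symmetric] q_vandermonde[OF q A])
    also have "\<dots> = a ^ r * q ^ (r\<^sup>2) * \<alpha> r / (qpoch q q (n - r) * qpoch (a * q) q (n + r))"
    proof -
      have "2 * r + (n - r) = n + r" using r by simp
      hence "qpoch (a * q) q (n + r) = qpoch (a * q) q (2 * r) * qpoch (A * q) q (n - r)"
        using poch[of "n - r"] by (simp add: add.commute)
      thus ?thesis by (simp add: mult_ac)
    qed
    finally show "(\<Sum>j\<le>n - r. ?g (r + j) r) = \<dots>" .
  qed
  finally show "(\<Sum>k\<le>n. a ^ k * q ^ (k\<^sup>2) * \<beta> k / qpoch q q (n - k)) = \<dots>" .
qed

section \<open>The unit Bailey pair\<close>

lemma qpoch_shift: "(1 - a) * qpoch (a * q) q n = qpoch a q (Suc n)"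
  using qpoch_add[of a q 1 n] by (simp add: qpoch_def)

text \<open>The truncated sums have a closed product form containing \<open>1 - q ^ (n - m)\<close>,
  which vanishes at \<open>m = n\<close>. The case \<open>n = 0\<close> stands apart because that
  form divides by \<open>1 - q ^ n\<close>.\<close>

lemma bailey_pair_unit:
  assumes q: "norm q < 1" and a: "\<And>i. a * q ^ i \<noteq> 1"
  shows "bailey_pair a q (unit_alpha a q) (\<lambda>n. if n = 0 then 1 else 0)"
  unfolding bailey_pair_def
proof
  fix n
  have a1: "1 - a \<noteq> 0" using a[of 0] by simp
  define t where "t = (\<lambda>r. unit_alpha a q r / (qpoch q q (n - r) * qpoch (a * q) q (n + r)))"
  note nzq = qpoch_qq_nonzero[OF q]
  have nza: "qpoch (a * q) q k \<noteq> 0" for k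
    using a[of "Suc i" for i] by (intro qpoch_nonzero) (simp add: mult.assoc)
  have partial: "(\<Sum>r\<le>m. t r) = (-1) ^ m * q ^ (Suc m choose 2) * qpoch (a * q) q m
      * (1 - q ^ (n - m)) / (qpoch q q m * qpoch q q (n - m) * qpoch (a * q) q (n + m) * (1 - q ^ n))"
    if "m \<le> n" "n > 0" for m
    using that
  proof (induction m)
    case 0
    have "1 - q ^ n \<noteq> 0"
      using power_Suc_neq_1[OF q, of "n - 1"] 0 by (cases n) auto
    thus ?case using a1 by (simp add: t_def unit_alpha_def numeral_2_eq_2)
  next
    case (Suc m)
    define k where "k = n - Suc m"
    have n: "n - m = Suc k" "n - Suc m = k" "n = Suc m + k" using Suc.prems by (auto simp: k_def)
    define x y where "x = q ^ m" and "y = q ^ k"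
    define c where "c = (-1) ^ m * q ^ (Suc m choose 2) * qpoch (a * q) q m
         / (qpoch q q m * qpoch q q k * qpoch (a * q) q (n + m))"
    have pn: "q ^ n = q * x * y" by (simp add: n x_def y_def power_add)
    have nz: "1 - q * x * y \<noteq> 0" "1 - q * x \<noteq> 0" "1 - q * y \<noteq> 0" "1 - a * q * (q * x * y * x) \<noteq> 0"
      using power_Suc_neq_1[OF q, of "m + k"] power_Suc_neq_1[OF q, of m] power_Suc_neq_1[OF q, of k]
        a[of "Suc (n + m)"]
      by (auto simp: x_def y_def power_add n mult_ac)
    have ch: "Suc (Suc m) choose 2 = (Suc m choose 2) + Suc m" by (simp add: numeral_2_eq_2)
    \<comment> \<open>The factor \<open>1 - q ^ (n - m)\<close> cancels the last factor of
      \<open>qpoch q q (n - m)\<close>.\<close>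
    have L: "(\<Sum>r\<le>m. t r) = c / (1 - q * x * y)"
    proof -
      have e1: "qpoch q q (Suc k) = qpoch q q k * (1 - q * y)"
        by (simp add: qpoch_Suc y_def)
      have e2: "q ^ Suc k = q * y" by (simp add: y_def)
      show ?thesis
        using Suc.IH Suc.prems nz unfolding n(1) pn e1 e2 by (simp add: c_def mult.assoc)
    qed
    have T: "t (Suc m) = - c * (1 - a * (q * x)\<^sup>2) / ((1 - q * x) * (1 - a * q * (q * x * y * x)))"
    proof -
      have e1: "qpoch a q (Suc m) = (1 - a) * qpoch (a * q) q m"
        by (simp add: qpoch_shift)
      have e2: "qpoch (a * q) q (n + Suc m) = qpoch (a * q) q (n + m) * (1 - a * q * (q * x * y * x))"
        by (simp add: qpoch_Suc power_add pn flip: x_def)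
      have e4: "q ^ (2 * Suc m) = (q * x)\<^sup>2"
        by (simp add: x_def power2_eq_square power_add mult_2)
      show ?thesis
        unfolding t_def unit_alpha_def n(2) e1 e2 e4
        using a1 nz nzq[of m] nzq[of k] nza[of "n+m"]
        by (simp add: c_def qpoch_Suc divide_simps flip: x_def)
    qed
    have R: "(-1) ^ Suc m * q ^ (Suc (Suc m) choose 2) * qpoch (a * q) q (Suc m)
      * (1 - q ^ (n - Suc m)) / (qpoch q q (Suc m) * qpoch q q (n - Suc m) * qpoch (a * q) q (n + Suc m) * (1 - q ^ n))
      = - c * q * x * (1 - a * q * x) * (1 - y) / ((1 - q * x) * (1 - a * q * (q * x * y * x)) * (1 - q * x * y))"
      unfolding ch n(2) pn
      by (simp add: c_def qpoch_Suc power_add pn mult_ac flip: x_def y_def)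
    show ?case unfolding sum.atMost_Suc L T R using nz
      by (simp add: divide_simps) (simp add: algebra_simps power2_eq_square)
  qed
  show "(if n = 0 then 1 else 0) = (\<Sum>r\<le>n. unit_alpha a q r / (qpoch q q (n - r) * qpoch (a * q) q (n + r)))"
  proof (cases "n = 0")
    case True
    thus ?thesis using a1 by (simp add: unit_alpha_def numeral_2_eq_2)
  next
    case False
    thus ?thesis using partial[of n] unfolding t_def by simp
  qed
qed

section \<open>A Bailey pair linking base \<open>q\<close> with base \<open>q ^ 3\<close>\<close>

definition cubic_alpha :: "complex \<Rightarrow> complex \<Rightarrow> nat \<Rightarrow> complex"
  where "cubic_alpha a q n =
    (if 3 dvd n then a ^ (n div 3) * (q ^ 3) ^ ((n div 3)\<^sup>2) * unit_alpha a (q ^ 3) (n div 3) else 0)"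

text \<open>The sum over \<open>r\<close> is a terminating very-well-poised \<open>\<^sub>6\<phi>\<^sub>5\<close> in base \<open>q\<^sup>3\<close> with parameters
  \<open>q\<^bsup>-n\<^esup>, q\<^bsup>1-n\<^esup>, q\<^bsup>2-n\<^esup>\<close>. Raising \<open>n\<close> only replaces the last one by \<open>q\<^bsup>-1-n\<^esup>\<close>, so it satisfies a first-order
  recurrence; \<open>G\<close> in the proof is the Wilf-Zeilberger certificate for it.\<close>

lemma cubic_recurrence:
  fixes a q :: complex
  assumes q: "norm q < 1" "q \<noteq> 0" and a: "\<And>i. a * q ^ i \<noteq> 1"
  defines "t \<equiv> (\<lambda>n r. a ^ r * (q ^ 3) ^ (r\<^sup>2) * unit_alpha a (q ^ 3) r
                * inv_qq q (int n - 3 * int r) / qpoch (a * q) q (n + 3 * r))"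
  shows "(1 - q ^ Suc n) * (1 - a * q ^ (2 * n)) * (1 - a * q ^ Suc (2 * n)) * (\<Sum>r\<le>Suc n. t (Suc n) r)
       = (1 - a * q ^ (3 * n)) * (\<Sum>r\<le>n. t n r)"
proof -
  have Q: "norm (q ^ 3) < 1" using q(1) by (simp add: norm_power power_less_one_iff)
  have a1: "1 - a \<noteq> 0" using a[of 0] by simp
  have nzq: "qpoch (q ^ 3) (q ^ 3) k \<noteq> 0" for k by (rule qpoch_qq_nonzero[OF Q])
  have nza: "qpoch (a * q) q k \<noteq> 0" for k
    using a[of "Suc i" for i] by (intro qpoch_nonzero) (simp add: mult.assoc)
  define N where "N = q ^ n"
  \<comment> \<open>The summand without its factor \<open>1 - a * q ^ (6 * r)\<close>, which is kept
    apart for the rational identity \<open>key\<close>.\<close>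
  define b where "b = (\<lambda>r. a ^ r * (q ^ 3) ^ (r\<^sup>2) * (-1) ^ r * (q ^ 3) ^ (r choose 2)
     * qpoch a (q ^ 3) r / ((1 - a) * qpoch (q ^ 3) (q ^ 3) r))"
  define U where "U = (\<lambda>r. inv_qq q (int (Suc n) - 3 * int r))"
  define W where "W = (\<lambda>r. 1 / qpoch (a * q) q (Suc n + 3 * r))"
  \<comment> \<open>\<open>H r\<close> is \<open>G (Suc r)\<close> written with the factors of index
    \<open>r\<close> (see \<open>GS\<close>), so that \<open>rec\<close> can be checked at a single
    \<open>r\<close>.\<close>
  define H where "H = (\<lambda>r. b r * W r * a * q * N * (q ^ (3 * r))\<^sup>2 * (1 - a * q ^ (3 * r))
     * inv_qq q (int n - 2 - 3 * int r))"
  define G where "G = (\<lambda>r. let y = q ^ (3 * r) in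
     - b r * U r * W r * N / y * (1 - y) * (q - a * N * y) * (1 - a * N * y) * (1 - a * q * N * y))"
  define K where "K = (1 - q ^ Suc n) * (1 - a * q ^ (2 * n)) * (1 - a * q ^ Suc (2 * n))"
  have rec: "K * t (Suc n) r - (1 - a * q ^ (3 * n)) * t n r = H r - G r" for r
  proof -
    define y where "y = q ^ (3 * r)"
    have y: "y \<noteq> 0" using q(2) by (simp add: y_def)
    have powi: "q powi (int m - 3 * int r) = q ^ m / y" for m
      using q(2) by (simp add: power_int_diff y_def power_int_mult flip: power_mult)
    have u0: "inv_qq q (int n - 3 * int r) = (1 - q * N / y) * U r"
      using inv_qq_diff_1[OF q(1), of "int (Suc n) - 3 * int r"] unfolding powi
      by (simp add: U_def N_def)
    have u1: "inv_qq q (int n - 1 - 3 * int r) = (1 - N / y) * inv_qq q (int n - 3 * int r)"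
      using inv_qq_diff_1[OF q(1), of "int n - 3 * int r"] unfolding powi
      by (simp add: N_def algebra_simps)
    have "q powi (int n - 1 - 3 * int r) = N / (q * y)"
      using q(2) powi[of n] by (simp add: power_int_diff N_def y_def)
    hence u2: "inv_qq q (int n - 2 - 3 * int r) = (1 - N / (q * y)) * inv_qq q (int n - 1 - 3 * int r)"
      using inv_qq_diff_1[OF q(1), of "int n - 1 - 3 * int r"]
      by (simp add: algebra_simps)
    have ua: "a ^ r * (q ^ 3) ^ (r\<^sup>2) * unit_alpha a (q ^ 3) r = b r * (1 - a * y\<^sup>2)"
      by (simp add: unit_alpha_def b_def y_def mult_ac flip: power_mult)
    have w: "1 / qpoch (a * q) q (n + 3 * r) = (1 - a * q * N * y) * W r"
    proof -
      have "qpoch (a * q) q (Suc n + 3 * r) = qpoch (a * q) q (n + 3 * r) * (1 - a * q * N * y)"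
        by (simp add: qpoch_Suc N_def y_def power_add mult_ac)
      thus ?thesis using nza[of "Suc n + 3 * r"] by (simp add: W_def)
    qed
    have t1: "t (Suc n) r = b r * (1 - a * y\<^sup>2) * U r * W r"
      unfolding t_def ua by (simp add: U_def W_def)
    have t0: "t n r = b r * (1 - a * y\<^sup>2) * ((1 - q * N / y) * U r) * ((1 - a * q * N * y) * W r)"
      unfolding t_def ua u0 w[symmetric] by simp
    have pw: "q ^ Suc n = q * N" "q ^ (2 * n) = N\<^sup>2" "q ^ Suc (2 * n) = q * N\<^sup>2" "q ^ (3 * n) = N ^ 3"
      by (simp_all add: N_def mult.commute flip: power_mult)
    \<comment> \<open>What is left of \<open>rec\<close> once the common factor
      \<open>b r * U r * W r\<close> is taken out.\<close>
    have key: "(1 - a * y\<^sup>2) * ((1 - q * N) * (1 - a * N\<^sup>2) * (1 - a * (q * N\<^sup>2))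
           - (1 - a * N ^ 3) * (1 - q * N / y) * (1 - a * q * N * y))
         = a * q * N * y\<^sup>2 * (1 - a * y) * ((1 - N / (q * y)) * ((1 - N / y) * (1 - q * N / y)))
           + N / y * (1 - y) * (q - a * N * y) * (1 - a * N * y) * (1 - a * q * N * y)"
      using y q(2) by (simp add: divide_simps) algebra
    have "K * t (Suc n) r - (1 - a * q ^ (3 * n)) * t n r
      = b r * U r * W r * ((1 - a * y\<^sup>2) * ((1 - q * N) * (1 - a * N\<^sup>2) * (1 - a * (q * N\<^sup>2))
           - (1 - a * N ^ 3) * (1 - q * N / y) * (1 - a * q * N * y)))"
      unfolding K_def t0 t1 pw by (simp only: algebra_simps)
    also have "\<dots> = H r - G r"
      unfolding key H_def G_def Let_def y_def[symmetric] u2 u1 u0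
      by (simp add: field_simps)
    finally show ?thesis .
  qed
  \<comment> \<open>The factor \<open>1 - y\<close> vanishes at \<open>r = 0\<close>, so there is no
    lower boundary term.\<close>
  have G0: "G 0 = 0" by (simp add: G_def)
  have GS: "G (Suc r) = H r" for r
  proof -
    define x where "x = q ^ (3 * r)"
    have x: "x \<noteq> 0" using q(2) by (simp add: x_def)
    have x': "q ^ (3 * Suc r) = q ^ 3 * x" by (simp add: x_def power_add)
    have nzr: "1 - q ^ 3 * x \<noteq> 0"
      using power_Suc_neq_1[OF Q, of r] by (simp add: x_def power_mult)
    have b: "b (Suc r) = - b r * a * (q ^ 3 * x ^ 3) * (1 - a * x) / (1 - q ^ 3 * x)"
    proof -
      have c: "Suc r choose 2 = (r choose 2) + r" by (simp add: numeral_2_eq_2)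
      have s: "(Suc r)\<^sup>2 = r\<^sup>2 + 2 * r + 1" by (simp add: power2_eq_square)
      have p: "(q ^ 3) ^ ((Suc r)\<^sup>2) * (q ^ 3) ^ (Suc r choose 2)
             = (q ^ 3) ^ (r\<^sup>2) * (q ^ 3) ^ (r choose 2) * (q ^ 3 * x ^ 3)"
        unfolding c s power_add mult_2 power_one_right power_mult[symmetric] x_def[symmetric]
        by (simp add: power3_eq_cube mult_ac)
      have "b (Suc r) = a ^ Suc r * (-1) ^ Suc r * ((q ^ 3) ^ ((Suc r)\<^sup>2) * (q ^ 3) ^ (Suc r choose 2))
          * qpoch a (q ^ 3) (Suc r) / ((1 - a) * qpoch (q ^ 3) (q ^ 3) (Suc r))"
        by (simp only: b_def mult_ac)
      also have "qpoch a (q ^ 3) (Suc r) = qpoch a (q ^ 3) r * (1 - a * x)"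
        by (simp add: qpoch_Suc x_def power_mult)
      also have "qpoch (q ^ 3) (q ^ 3) (Suc r) = qpoch (q ^ 3) (q ^ 3) r * (1 - q ^ 3 * x)"
        by (simp add: qpoch_Suc x_def power_mult)
      finally show ?thesis
        unfolding p by (simp add: b_def mult_ac)
    qed
    have u: "U (Suc r) = inv_qq q (int n - 2 - 3 * int r)"
      by (simp add: U_def algebra_simps)
    \<comment> \<open>Passing from \<open>r\<close> to \<open>Suc r\<close> adds three factors to
      the denominator of \<open>W\<close>; the first of them appears here multiplied by
      \<open>q\<close>.\<close>
    have w: "(q - a * N * (q ^ 3 * x)) * (1 - a * N * (q ^ 3 * x)) * (1 - a * q * N * (q ^ 3 * x)) * W (Suc r)
           = q * W r"
    proof -
      have "Suc n + 3 * Suc r = Suc (Suc (Suc (Suc n + 3 * r)))" by simp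
      hence "qpoch (a * q) q (Suc n + 3 * Suc r) = qpoch (a * q) q (Suc n + 3 * r)
        * (1 - a * N * q ^ 2 * x) * (1 - a * N * (q ^ 3 * x)) * (1 - a * q * N * (q ^ 3 * x))"
        by (simp add: qpoch_Suc N_def x_def power_add mult_ac eval_nat_numeral)
      moreover have "q - a * N * (q ^ 3 * x) = q * (1 - a * N * q ^ 2 * x)"
        by (simp add: algebra_simps eval_nat_numeral)
      ultimately show ?thesis using nza[of "Suc n + 3 * Suc r"]
        by (simp add: W_def)
    qed
    have "G (Suc r) = - b (Suc r) * U (Suc r) * N / (q ^ 3 * x) * (1 - q ^ 3 * x) *
      ((q - a * N * (q ^ 3 * x)) * (1 - a * N * (q ^ 3 * x)) * (1 - a * q * N * (q ^ 3 * x)) * W (Suc r))"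
      unfolding G_def Let_def x' by (simp only: mult_ac divide_inverse minus_mult_left)
    also have "\<dots> = H r"
      unfolding w b u H_def x_def[symmetric] using x nzr q(2)
      by (simp add: divide_simps) (simp add: eval_nat_numeral)
    finally show ?thesis .
  qed
  have tel: "(\<Sum>r\<le>m. K * t (Suc n) r - (1 - a * q ^ (3 * n)) * t n r) = H m" for m
    by (induction m) (simp_all add: rec G0 GS)
  \<comment> \<open>Here and in \<open>H (Suc n) = 0\<close> the argument of \<open>inv_qq\<close>
    is negative. The first fact aligns the two ranges, the second removes the upper boundary
    term.\<close>
  have z: "t n (Suc n) = 0" by (simp add: t_def inv_qq_def)
  have "H (Suc n) = 0" by (simp add: H_def inv_qq_def)
  hence "(\<Sum>r\<le>Suc n. K * t (Suc n) r - (1 - a * q ^ (3 * n)) * t n r) = 0"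
    by (subst tel)
  hence "K * (\<Sum>r\<le>Suc n. t (Suc n) r) = (1 - a * q ^ (3 * n)) * (\<Sum>r\<le>n. t n r)"
    unfolding sum_subtractf sum_distrib_left[symmetric] sum.atMost_Suc[of "t n"] z by simp
  thus ?thesis unfolding K_def .
qed

text \<open>Both sides equal 1 at \<open>n = 0\<close> and obey the same first-order recurrence in
  \<open>n\<close>.\<close>

lemma bailey_pair_cubic:
  assumes q: "norm q < 1" "q \<noteq> 0" and a: "\<And>i. a * q ^ i \<noteq> 1"
  shows "bailey_pair a q (cubic_alpha a q)
           (\<lambda>n. qpoch a (q ^ 3) n / (qpoch a q (2 * n) * qpoch q q n))"
  unfolding bailey_pair_def
proof
  fix n
  define t where "t = (\<lambda>n r. a ^ r * (q ^ 3) ^ (r\<^sup>2) * unit_alpha a (q ^ 3) r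
                * inv_qq q (int n - 3 * int r) / qpoch (a * q) q (n + 3 * r))"
  have a1: "1 - a \<noteq> 0" using a[of 0] by simp
  have "qpoch a (q ^ 3) n / (qpoch a q (2 * n) * qpoch q q n) = (\<Sum>r\<le>n. t n r)"
  proof (induction n)
    case 0
    thus ?case using a1 by (simp add: t_def inv_qq_def unit_alpha_def numeral_2_eq_2)
  next
    case (Suc n)
    define K where "K = (1 - q ^ Suc n) * (1 - a * q ^ (2 * n)) * (1 - a * q ^ Suc (2 * n))"
    have K: "K \<noteq> 0"
      using power_Suc_neq_1[OF q(1), of n] a[of "2 * n"] a[of "Suc (2 * n)"] by (simp add: K_def)
    have "K * (\<Sum>r\<le>Suc n. t (Suc n) r) = (1 - a * q ^ (3 * n)) * (\<Sum>r\<le>n. t n r)"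
      unfolding K_def t_def by (rule cubic_recurrence[OF q a])
    hence "(\<Sum>r\<le>Suc n. t (Suc n) r) = (1 - a * q ^ (3 * n)) * (\<Sum>r\<le>n. t n r) / K"
      using K by (metis nonzero_mult_div_cancel_left)
    also have "\<dots> = qpoch a (q ^ 3) (Suc n) / (qpoch a q (2 * Suc n) * qpoch q q (Suc n))"
      unfolding Suc.IH[symmetric] K_def power_mult[of q 3] by (simp add: qpoch_Suc mult_ac)
    finally show ?case ..
  qed
  \<comment> \<open>\<open>inv_qq\<close> cuts the sum off at \<open>3 * r \<le> n\<close>; the
    index \<open>3 * r\<close> then runs over the support of \<open>cubic_alpha\<close>.\<close>
  also have "\<dots> = (\<Sum>r | r \<le> n \<and> 3 * r \<le> n. t n r)"
    by (intro sum.mono_neutral_right) (auto simp: t_def inv_qq_def)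
  also have "\<dots> = (\<Sum>r | r \<le> n \<and> 3 dvd r. cubic_alpha a q r / (qpoch q q (n - r) * qpoch (a * q) q (n + r)))"
    by (rule sum.reindex_bij_witness[where i = "\<lambda>r. r div 3" and j = "\<lambda>r. 3 * r"])
       (use inv_qq_of_nat[of "3 * r" n q for r] in \<open>auto simp: t_def cubic_alpha_def\<close>)
  also have "\<dots> = (\<Sum>r\<le>n. cubic_alpha a q r / (qpoch q q (n - r) * qpoch (a * q) q (n + r)))"
    by (intro sum.mono_neutral_left) (auto simp: cubic_alpha_def)
  finally show "qpoch a (q ^ 3) n / (qpoch a q (2 * n) * qpoch q q n) = \<dots>" .
qed

section \<open>Gaussian-type series, bounded sequences and passage to the limit\<close>

text \<open>Successive terms have ratio \<open>norm c * norm q ^ (2 * n + 1)\<close>, which tends to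
  0.\<close>

lemma summable_gaussian:
  fixes c q :: complex
  assumes "norm q < 1"
  shows "summable (\<lambda>n. norm (c ^ n * q ^ (n\<^sup>2)))"
proof -
  have "(\<lambda>n. norm c * norm q ^ n) \<longlonglongrightarrow> norm c * 0"
    using assms by (intro tendsto_intros LIMSEQ_power_zero) auto
  hence "eventually (\<lambda>n. norm c * norm q ^ n < 1 / 2) sequentially"
    by (rule order_tendstoD(2)) simp
  then obtain N where N: "\<And>n. n \<ge> N \<Longrightarrow> norm c * norm q ^ n < 1 / 2"
    by (auto simp: eventually_at_top_linorder)
  show ?thesis
  proof (rule summable_ratio_test)
    fix n assume "n \<ge> N"
    have "norm (c ^ Suc n * q ^ ((Suc n)\<^sup>2))
        = (norm c * norm q ^ n) * norm q ^ Suc n * norm (c ^ n * q ^ (n\<^sup>2))"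
      by (simp add: power2_eq_square norm_mult norm_power power_add mult_ac)
    also have "\<dots> \<le> (1 / 2) * 1 * norm (c ^ n * q ^ (n\<^sup>2))"
      using N[OF \<open>n \<ge> N\<close>] assms
      by (intro mult_mono mult_nonneg_nonneg power_le_one) auto
    finally show "norm (norm (c ^ Suc n * q ^ ((Suc n)\<^sup>2))) \<le> 1 / 2 * norm (norm (c ^ n * q ^ (n\<^sup>2)))"
      by simp
  qed simp
qed

text \<open>Reduces the summability conditions of the limiting Bailey lemma to boundedness of
  \<open>\<alpha>\<close> and \<open>\<beta>\<close>.\<close>

lemma summable_gaussian_Bseq:
  fixes c q :: complex
  assumes "norm q < 1" "Bseq B"
  shows "summable (\<lambda>n. norm (c ^ n * q ^ (n\<^sup>2) * B n))"
proof -
  obtain K where K: "\<And>n. norm (B n) \<le> K" using assms(2) by (auto simp: Bseq_def)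
  show ?thesis
  proof (rule summable_comparison_test')
    show "summable (\<lambda>n. norm (c ^ n * q ^ (n\<^sup>2)) * K)"
      by (intro summable_mult2 summable_gaussian assms)
    show "norm (norm (c ^ n * q ^ (n\<^sup>2) * B n)) \<le> norm (c ^ n * q ^ (n\<^sup>2)) * K" if "n \<ge> 0" for n
      using K[of n] by (simp add: norm_mult mult_left_mono)
  qed
qed

lemma Bseq_qpoch: "norm p < 1 \<Longrightarrow> Bseq (qpoch A p)"
  using qpoch_tendsto_qpoch_inf convergent_imp_Bseq convergentI by blast

lemma qpoch_inf_nonzero:
  assumes "norm p < 1" "\<And>i. A * p ^ i \<noteq> 1"
  shows "qpoch_inf A p \<noteq> 0"
  unfolding qpoch_inf_def
  by (rule prodinf_nonzero[OF convergent_prod_qpoch_inf]) (use assms in auto)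

lemma tendsto_inverse_qpoch:
  assumes "norm p < 1" "\<And>i. A * p ^ i \<noteq> 1"
  shows "(\<lambda>n. inverse (qpoch A p n)) \<longlonglongrightarrow> inverse (qpoch_inf A p)"
  by (intro tendsto_inverse qpoch_tendsto_qpoch_inf qpoch_inf_nonzero assms)

lemma Bseq_inverse_qpoch:
  assumes "norm p < 1" "\<And>i. A * p ^ i \<noteq> 1"
  shows "Bseq (\<lambda>n. inverse (qpoch A p n))"
  using tendsto_inverse_qpoch[OF assms] convergent_imp_Bseq convergentI by blast

lemma Bseq_power:
  fixes c :: complex
  shows "norm c \<le> 1 \<Longrightarrow> Bseq (\<lambda>n. c ^ f n)"
  by (rule BseqI'[of _ 1]) (simp add: norm_power power_le_one)

lemma Bseq_unit_alpha:
  assumes "norm q < 1"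
  shows "Bseq (unit_alpha a q)"
proof -
  have "Bseq (\<lambda>r. (-1) ^ r * q ^ (r choose 2) * (q ^ (2 * r) * - a + 1) * qpoch a q r
                  * inverse (qpoch q q r) * inverse (1 - a))"
    using assms power_Suc_neq_1[OF assms]
    by (intro Bseq_mult Bseq_inverse_qpoch Bseq_qpoch Bfun_const Bseq_power iffD2[OF Bseq_add_iff]) auto
  thus ?thesis
    by (simp add: unit_alpha_def[abs_def] divide_inverse mult_ac)
qed

text \<open>For fixed \<open>k\<close> both \<open>n - k\<close> and \<open>n + k\<close> tend to
  infinity, and the convergent weights are bounded, so \<open>norm (f k)\<close> times a constant
  dominates.\<close>

lemma tannery_weighted:
  fixes f :: "nat \<Rightarrow> complex"
  assumes f: "summable (\<lambda>n. norm (f n))" and u: "u \<longlonglongrightarrow> u0" and v: "v \<longlonglongrightarrow> v0"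
  shows "(\<lambda>n. \<Sum>k\<le>n. f k * u (n - k) * v (n + k)) \<longlonglongrightarrow> suminf f * u0 * v0"
proof -
  obtain C where C: "C > 0" "\<And>n. norm (u n) \<le> C"
    using convergent_imp_Bseq[OF convergentI[OF u]] by (auto simp: Bseq_def)
  obtain D where D: "D > 0" "\<And>n. norm (v n) \<le> D"
    using convergent_imp_Bseq[OF convergentI[OF v]] by (auto simp: Bseq_def)
  \<comment> \<open>Padding by 0 gives an infinite series over a fixed index set and excludes the
    truncated values of \<open>n - k\<close>.\<close>
  define g where "g = (\<lambda>k n. if k \<le> n then f k * u (n - k) * v (n + k) else 0)"
  have "(\<lambda>n. \<Sum>k. g k n) \<longlonglongrightarrow> (\<Sum>k. f k * u0 * v0)"
  proof (rule tannerys_theorem[THEN conjunct2, THEN conjunct2])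
    show "(g k \<longlongrightarrow> f k * u0 * v0) sequentially" for k
    proof (rule Lim_transform_eventually)
      show "(\<lambda>n. f k * u (n - k) * v (n + k)) \<longlonglongrightarrow> f k * u0 * v0"
        by (intro tendsto_intros LIMSEQ_ignore_initial_segment v
              filterlim_compose[OF u filterlim_minus_const_nat_at_top])
      show "\<forall>\<^sub>F n in sequentially. f k * u (n - k) * v (n + k) = g k n"
        using eventually_ge_at_top[of k] by eventually_elim (simp add: g_def)
    qed
    show "\<forall>\<^sub>F (k, n) in sequentially \<times>\<^sub>F sequentially. norm (g k n) \<le> norm (f k) * C * D"
      using C D by (intro always_eventually)
        (auto simp: g_def norm_mult intro!: mult_mono mult_nonneg_nonneg)
    show "summable (\<lambda>k. norm (f k) * C * D)"
      by (intro summable_mult2 f)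
  qed simp
  also have "(\<lambda>n. \<Sum>k. g k n) = (\<lambda>n. \<Sum>k\<le>n. f k * u (n - k) * v (n + k))"
  proof
    fix n
    have "(\<Sum>k. g k n) = (\<Sum>k\<le>n. g k n)"
      by (rule suminf_finite) (auto simp: g_def)
    thus "(\<Sum>k. g k n) = (\<Sum>k\<le>n. f k * u (n - k) * v (n + k))"
      by (simp add: g_def)
  qed
  also have "(\<Sum>k. f k * u0 * v0) = suminf f * u0 * v0"
    using suminf_mult2[OF summable_norm_cancel[OF f], of "u0 * v0"] by (simp add: mult.assoc)
  finally show ?thesis .
qed

section \<open>The limiting Bailey lemma\<close>

text \<open>Let \<open>n\<close> tend to infinity in \<open>bailey_lemma\<close>: both sides acquire
  the nonzero factor \<open>inverse (qpoch_inf q q)\<close>, which cancels.\<close>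

lemma bailey_limit:
  assumes q: "norm q < 1" "q \<noteq> 0" and a: "\<And>i. a * q ^ i \<noteq> 1"
    and pair: "bailey_pair a q \<alpha> \<beta>"
    and \<alpha>: "summable (\<lambda>n. norm (a ^ n * q ^ (n\<^sup>2) * \<alpha> n))"
    and \<beta>: "summable (\<lambda>n. norm (a ^ n * q ^ (n\<^sup>2) * \<beta> n))"
  shows "(\<Sum>n. a ^ n * q ^ (n\<^sup>2) * \<beta> n) = (\<Sum>n. a ^ n * q ^ (n\<^sup>2) * \<alpha> n) / qpoch_inf (a * q) q"
proof -
  have aq: "a * q * q ^ i \<noteq> 1" for i using a[of "Suc i"] by (simp add: mult.assoc)
  note tq = tendsto_inverse_qpoch[OF q(1) power_Suc_neq_1[OF q(1)]]
  have "(\<lambda>n. \<Sum>k\<le>n. a ^ k * q ^ (k\<^sup>2) * \<beta> k * inverse (qpoch q q (n - k)) * 1)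
      \<longlonglongrightarrow> (\<Sum>n. a ^ n * q ^ (n\<^sup>2) * \<beta> n) * inverse (qpoch_inf q q) * 1"
    by (rule tannery_weighted[OF \<beta> tq tendsto_const])
  moreover have "(\<lambda>n. \<Sum>k\<le>n. a ^ k * q ^ (k\<^sup>2) * \<alpha> k * inverse (qpoch q q (n - k))
                           * inverse (qpoch (a * q) q (n + k)))
      \<longlonglongrightarrow> (\<Sum>n. a ^ n * q ^ (n\<^sup>2) * \<alpha> n) * inverse (qpoch_inf q q) * inverse (qpoch_inf (a * q) q)"
    by (rule tannery_weighted[OF \<alpha> tq tendsto_inverse_qpoch[OF q(1) aq]])
  moreover have "(\<Sum>k\<le>n. a ^ k * q ^ (k\<^sup>2) * \<beta> k * inverse (qpoch q q (n - k)) * 1)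
      = (\<Sum>k\<le>n. a ^ k * q ^ (k\<^sup>2) * \<alpha> k * inverse (qpoch q q (n - k)) * inverse (qpoch (a * q) q (n + k)))"
    for n
    using bailey_lemma[OF q a pair] by (simp add: bailey_pair_def divide_inverse mult_ac)
  ultimately have "(\<Sum>n. a ^ n * q ^ (n\<^sup>2) * \<beta> n) * inverse (qpoch_inf q q) =
      (\<Sum>n. a ^ n * q ^ (n\<^sup>2) * \<alpha> n) * inverse (qpoch_inf q q) * inverse (qpoch_inf (a * q) q)"
    using LIMSEQ_unique by fastforce
  thus ?thesis
    using qpoch_inf_nonzero[OF q(1) power_Suc_neq_1[OF q(1)]] by (simp add: field_simps)
qed

text \<open>The new sequence even converges, by \<open>tannery_weighted\<close> with
  \<open>v\<close> constantly 1; boundedness thus survives iterated steps.\<close>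

lemma Bseq_bailey_step:
  assumes q: "norm q < 1" and \<beta>: "Bseq \<beta>"
  shows "Bseq (\<lambda>n. \<Sum>k\<le>n. a ^ k * q ^ (k\<^sup>2) * \<beta> k / qpoch q q (n - k))"
proof -
  have "(\<lambda>n. \<Sum>k\<le>n. a ^ k * q ^ (k\<^sup>2) * \<beta> k * inverse (qpoch q q (n - k)) * 1)
      \<longlonglongrightarrow> (\<Sum>n. a ^ n * q ^ (n\<^sup>2) * \<beta> n) * inverse (qpoch_inf q q) * 1"
    by (intro tannery_weighted tendsto_inverse_qpoch summable_gaussian_Bseq
         power_Suc_neq_1 tendsto_const q \<beta>)
  from convergent_imp_Bseq[OF convergentI[OF this]] show ?thesis
    by (simp add: divide_inverse)
qed

section \<open>Absolute convergence and regrouping of the triple sum\<close>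

lemma infsum_nat_eq_suminf:
  fixes f :: "nat \<Rightarrow> complex"
  assumes "f summable_on UNIV"
  shows "infsum f UNIV = suminf f"
  using has_sum_imp_sums[OF has_sum_infsum[OF assms]] by (simp add: sums_iff)

lemma abs_summable_on_times:
  fixes f :: "'a \<Rightarrow> complex" and g :: "'b \<Rightarrow> complex"
  assumes "(\<lambda>x. norm (f x)) summable_on A" "(\<lambda>y. norm (g y)) summable_on B"
  shows "(\<lambda>z. norm (f (fst z) * g (snd z))) summable_on A \<times> B"
  unfolding Infinite_Sum.abs_summable_on_Sigma_iff using assms
  by (auto simp: norm_mult infsum_cmult_right' abs_mult infsum_nonneg
           intro!: summable_on_cmult_right summable_on_cmult_left)

context
  fixes a q :: complex and F :: "nat \<Rightarrow> nat \<Rightarrow> nat \<Rightarrow> complex"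
  assumes q: "norm q < 1"
  defines "F \<equiv> (\<lambda>r s t. a ^ (r + 2 * s + 3 * t) * q ^ ((r + s + t)\<^sup>2 + (s + t)\<^sup>2 + t\<^sup>2)
              / (qpoch q q r * qpoch q q s * qpoch q q t))"
begin

text \<open>The quadratic form exceeds \<open>r\<^sup>2 + s\<^sup>2 + t\<^sup>2\<close> by some
  \<open>e \<ge> 0\<close>, so a product of three Gaussian-type series in \<open>a\<close>,
  \<open>a\<^sup>2\<close> and \<open>a ^ 3\<close> dominates.\<close>

lemma abs_summable_triple: "(\<lambda>(r, s, t). norm (F r s t)) summable_on UNIV"
proof -
  define f where "f = (\<lambda>c n. c ^ n * q ^ (n\<^sup>2) * inverse (qpoch q q n))"
  have f: "(\<lambda>n. norm (f c n)) summable_on UNIV" for c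
    unfolding f_def using power_Suc_neq_1[OF q]
    by (intro norm_summable_imp_summable_on)
       (simp only: real_norm_def abs_norm_cancel, intro summable_gaussian_Bseq Bseq_inverse_qpoch q)
  define g where "g = (\<lambda>z. f a (fst z) * (f (a\<^sup>2) (fst (snd z)) * f (a ^ 3) (snd (snd z))))"
  have "(\<lambda>z. norm (g z)) summable_on UNIV \<times> UNIV \<times> UNIV"
    unfolding g_def by (rule abs_summable_on_times[OF f abs_summable_on_times[OF f f]])
  hence "(\<lambda>z. norm (g z)) summable_on UNIV" by simp
  hence "(\<lambda>z. norm (case z of (r, s, t) \<Rightarrow> F r s t)) summable_on UNIV"
  proof (rule Infinite_Sum.abs_summable_on_comparison_test)
    fix z :: "nat \<times> nat \<times> nat"
    obtain r s t where z: "z = (r, s, t)" by (cases z) auto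
    define e where "e = 2 * (r * s + r * t + 2 * s * t) + s\<^sup>2 + 2 * t\<^sup>2"
    have a: "a ^ (r + 2 * s + 3 * t) = a ^ r * (a\<^sup>2) ^ s * (a ^ 3) ^ t"
      by (simp add: power_add power_mult)
    have e: "(r + s + t)\<^sup>2 + (s + t)\<^sup>2 + t\<^sup>2 = e + r\<^sup>2 + s\<^sup>2 + t\<^sup>2"
      by (simp add: e_def power2_eq_square algebra_simps)
    have "F r s t = q ^ e * g z"
      unfolding F_def a e by (simp add: z g_def f_def power_add divide_inverse mult_ac)
    hence "norm (F r s t) = norm q ^ e * norm (g z)"
      by (simp add: norm_mult norm_power)
    also have "\<dots> \<le> 1 * norm (g z)"
      using q by (intro mult_right_mono power_le_one) auto
    finally show "norm (case z of (r, s, t) \<Rightarrow> F r s t) \<le> norm (g z)" by (simp add: z)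
  qed
  thus ?thesis by (simp add: case_prod_unfold)
qed

text \<open>With \<open>n = r + s + t\<close>, \<open>m = s + t\<close>, \<open>k = t\<close> the
  exponents become \<open>n + m + k\<close> and \<open>n\<^sup>2 + m\<^sup>2 + k\<^sup>2\<close>,
  which exhibits two nested Bailey steps applied to \<open>1 / qpoch q q k\<close>.\<close>

lemma triple_sum_eq:
  "(\<Sum>r. \<Sum>s. \<Sum>t. F r s t) = (\<Sum>n. a ^ n * q ^ (n\<^sup>2) *
     (\<Sum>m\<le>n. a ^ m * q ^ (m\<^sup>2) * (\<Sum>k\<le>m. a ^ k * q ^ (k\<^sup>2) * (1 / qpoch q q k)
        / qpoch q q (m - k)) / qpoch q q (n - m)))"
proof -
  have S: "(\<lambda>(r, s, t). F r s t) summable_on UNIV"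
    by (rule Infinite_Sum.abs_summable_summable)
       (use abs_summable_triple in \<open>simp add: case_prod_unfold\<close>)
  have S1: "(\<lambda>(r, z). (\<lambda>(s, t). F r s t) z) summable_on Sigma UNIV (\<lambda>_. UNIV)"
    using S by simp
  have S2: "(\<lambda>(s, t). F r s t) summable_on Sigma UNIV (\<lambda>_. UNIV)" for r
    using summable_on_SigmaD1[OF S1, of r] by simp
  have S3: "F r s summable_on UNIV" for r s
    using summable_on_SigmaD1[OF S2, of s] by simp
  \<comment> \<open>The iterated series is passed to an unordered sum because the reindexing below
    mixes the three indices.\<close>
  have "(\<Sum>\<^sub>\<infinity>(r, s, t). F r s t) = (\<Sum>\<^sub>\<infinity>r. \<Sum>\<^sub>\<infinity>s. \<Sum>\<^sub>\<infinity>t. F r s t)"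
    using infsum_Sigma'_banach[OF S1] infsum_Sigma'_banach[OF S2] by simp
  also have "\<dots> = (\<Sum>r. \<Sum>\<^sub>\<infinity>s. \<Sum>\<^sub>\<infinity>t. F r s t)"
    using summable_on_Sigma_banach[OF S1] infsum_Sigma'_banach[OF S2]
    by (intro infsum_nat_eq_suminf) simp
  also have "\<dots> = (\<Sum>r. \<Sum>s. \<Sum>t. F r s t)"
    using summable_on_Sigma_banach[OF S2] S3 by (simp add: infsum_nat_eq_suminf)
  finally have L: "(\<Sum>\<^sub>\<infinity>(r, s, t). F r s t) = (\<Sum>r. \<Sum>s. \<Sum>t. F r s t)" .

  define h where "h = (\<lambda>n (m, k). F (n - m) (m - k) k)"
  define T where "T = Sigma (UNIV :: nat set) (\<lambda>n. Sigma {..n} (\<lambda>m. {..m}))"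
  \<comment> \<open>Triples correspond to chains \<open>k \<le> m \<le> n\<close>, on which the
    natural-number subtractions are exact.\<close>
  note wit = summable_on_reindex_bij_witness[where S = UNIV and T = T
      and i = "\<lambda>(n, m, k). (n - m, m - k, k)" and j = "\<lambda>(r, s, t). (r + s + t, s + t, t)"]
    infsum_reindex_bij_witness[where S = UNIV and T = T
      and i = "\<lambda>(n, m, k). (n - m, m - k, k)" and j = "\<lambda>(r, s, t). (r + s + t, s + t, t)"]
  have ST: "(\<lambda>(n, z). h n z) summable_on T"
    using S by (subst (asm) wit(1)[where h = "\<lambda>(n, z). h n z"]) (auto simp: T_def h_def)
  have "(\<Sum>\<^sub>\<infinity>(r, s, t). F r s t) = infsum (\<lambda>(n, z). h n z) T"
    by (rule wit(2)) (auto simp: T_def h_def)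
  also have "\<dots> = (\<Sum>\<^sub>\<infinity>n. infsum (h n) (Sigma {..n} (\<lambda>m. {..m})))"
    using infsum_Sigma'_banach[OF ST[unfolded T_def]] by (simp add: T_def)
  also have "\<dots> = (\<Sum>n. infsum (h n) (Sigma {..n} (\<lambda>m. {..m})))"
    using summable_on_Sigma_banach[OF ST[unfolded T_def]] by (rule infsum_nat_eq_suminf)
  also have "\<dots> = (\<Sum>n. \<Sum>m\<le>n. \<Sum>k\<le>m. F (n - m) (m - k) k)"
    by (simp add: h_def sum.Sigma infsum_finite)
  also have "\<dots> = (\<Sum>n. a ^ n * q ^ (n\<^sup>2) *
     (\<Sum>m\<le>n. a ^ m * q ^ (m\<^sup>2) * (\<Sum>k\<le>m. a ^ k * q ^ (k\<^sup>2) * (1 / qpoch q q k)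
        / qpoch q q (m - k)) / qpoch q q (n - m)))"
  proof (intro suminf_cong)
    fix n
    have "F (n - m) (m - k) k = a ^ n * q ^ (n\<^sup>2) * (a ^ m * q ^ (m\<^sup>2) * (a ^ k * q ^ (k\<^sup>2) *
       (1 / qpoch q q k) / qpoch q q (m - k)) / qpoch q q (n - m))" if "m \<le> n" "k \<le> m" for m k
    proof -
      have "n - m + (m - k) + k = n" "m - k + k = m" "n - m + 2 * (m - k) + 3 * k = n + m + k"
        using that by auto
      thus ?thesis unfolding F_def by (simp only:) (simp add: power_add mult_ac)
    qed
    thus "(\<Sum>m\<le>n. \<Sum>k\<le>m. F (n - m) (m - k) k) = a ^ n * q ^ (n\<^sup>2) *
     (\<Sum>m\<le>n. a ^ m * q ^ (m\<^sup>2) * (\<Sum>k\<le>m. a ^ k * q ^ (k\<^sup>2) * (1 / qpoch q q k)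
        / qpoch q q (m - k)) / qpoch q q (n - m))"
      by (simp add: sum_distrib_left sum_divide_distrib)
  qed
  finally show ?thesis unfolding L .
qed

end

section \<open>Reduction of both sides to one single sum\<close>

lemma cubic_beta_summable:
  assumes q: "norm q < 1" and a: "\<And>i. a * q ^ i \<noteq> 1"
  shows "summable (\<lambda>j. norm (a ^ j * q ^ (j\<^sup>2) * (qpoch a (q ^ 3) j / (qpoch a q (2 * j) * qpoch q q j))))"
proof -
  have Q: "norm (q ^ 3) < 1" using q by (simp add: norm_power power_less_one_iff)
  have "Bseq (\<lambda>j. qpoch a (q ^ 3) j * inverse (qpoch a q (2 * j)) * inverse (qpoch q q j))"
    by (intro Bseq_mult Bseq_qpoch Q Bseq_inverse_qpoch power_Suc_neq_1 q a
          Bseq_subseq[OF Bseq_inverse_qpoch, of q a "\<lambda>j. 2 * j"])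
  from summable_gaussian_Bseq[OF q this, of a] show ?thesis
    by (simp add: divide_inverse mult_ac)
qed

text \<open>At index \<open>3 * r\<close> the limit contributes
  \<open>a ^ (3 * r) * q ^ (9 * r\<^sup>2)\<close>; with the factor
  \<open>a ^ r * q ^ (3 * r\<^sup>2)\<close> inside \<open>cubic_alpha\<close> this gives the fourth
  powers. All other indices contribute 0.\<close>

lemma cubic_sum:
  assumes q: "norm q < 1" "q \<noteq> 0" and a: "\<And>i. a * q ^ i \<noteq> 1"
  shows "(\<Sum>j. a ^ j * q ^ (j\<^sup>2) * (qpoch a (q ^ 3) j / (qpoch a q (2 * j) * qpoch q q j)))
       = (\<Sum>r. (a ^ 4) ^ r * ((q ^ 3) ^ 4) ^ (r\<^sup>2) * unit_alpha a (q ^ 3) r) / qpoch_inf (a * q) q"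
proof -
  have Q: "norm (q ^ 3) < 1" "norm ((q ^ 3) ^ 4) < 1"
    using q by (simp_all add: norm_power power_less_one_iff)
  have mono: "strict_mono (\<lambda>r::nat. 3 * r)" by (simp add: strict_mono_def)
  define f where "f = (\<lambda>n. a ^ n * q ^ (n\<^sup>2) * cubic_alpha a q n)"
  have f3: "f (3 * r) = (a ^ 4) ^ r * ((q ^ 3) ^ 4) ^ (r\<^sup>2) * unit_alpha a (q ^ 3) r" for r
  proof -
    have "a ^ (3 * r) * a ^ r = (a ^ 4) ^ r" "q ^ ((3 * r)\<^sup>2) * (q ^ 3) ^ (r\<^sup>2) = ((q ^ 3) ^ 4) ^ (r\<^sup>2)"
      by (simp_all add: power2_eq_square flip: power_add power_mult)
    moreover have "f (3 * r) = (a ^ (3 * r) * a ^ r) * (q ^ ((3 * r)\<^sup>2) * (q ^ 3) ^ (r\<^sup>2))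
        * unit_alpha a (q ^ 3) r"
      by (simp add: f_def cubic_alpha_def mult_ac)
    ultimately show ?thesis by simp
  qed
  have f0: "f n = 0" if "n \<notin> range (\<lambda>r. 3 * r)" for n
    using that by (auto simp: f_def cubic_alpha_def elim!: dvdE)
  have "summable (\<lambda>r. norm (f (3 * r)))"
    unfolding f3 by (intro summable_gaussian_Bseq Bseq_unit_alpha Q)
  hence "summable (\<lambda>n. norm (f n))"
    using summable_mono_reindex[OF mono, of "\<lambda>n. norm (f n)"] f0 by simp
  hence "(\<Sum>j. a ^ j * q ^ (j\<^sup>2) * (qpoch a (q ^ 3) j / (qpoch a q (2 * j) * qpoch q q j)))
       = (\<Sum>n. f n) / qpoch_inf (a * q) q"
    unfolding f_def
    by (intro bailey_limit[OF q a bailey_pair_cubic[OF q a]] cubic_beta_summable q(1) a)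
  also have "(\<Sum>n. f n) = (\<Sum>r. f (3 * r))"
    by (rule suminf_mono_reindex[OF mono f0, symmetric])
  finally show ?thesis unfolding f3 .
qed

text \<open>Three Bailey steps and the limit each multiply \<open>\<alpha>\<close> by
  \<open>a ^ r * q ^ (r\<^sup>2)\<close>, hence the fourth powers. The final theorem uses this with
  \<open>q ^ 3\<close> for \<open>q\<close>.\<close>

lemma triple_sum:
  assumes q: "norm q < 1" "q \<noteq> 0" and a: "\<And>i. a * q ^ i \<noteq> 1"
  shows "(\<Sum>r. \<Sum>s. \<Sum>t. a ^ (r + 2 * s + 3 * t) * q ^ ((r + s + t)\<^sup>2 + (s + t)\<^sup>2 + t\<^sup>2)
              / (qpoch q q r * qpoch q q s * qpoch q q t))
       = (\<Sum>r. (a ^ 4) ^ r * (q ^ 4) ^ (r\<^sup>2) * unit_alpha a q r) / qpoch_inf (a * q) q"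
proof -
  define step where "step = (\<lambda>\<beta> n. \<Sum>k\<le>n. a ^ k * q ^ (k\<^sup>2) * \<beta> k / qpoch q q (n - k))"
  define mul where "mul = (\<lambda>\<alpha> r. a ^ r * q ^ (r\<^sup>2) * \<alpha> r)"
  have pair: "bailey_pair a q (mul \<alpha>) (step \<beta>)" if "bailey_pair a q \<alpha> \<beta>" for \<alpha> \<beta>
    using bailey_lemma[OF q a that] by (simp add: mul_def step_def)
  \<comment> \<open>Only \<open>k = 0\<close> survives, so the first step yields the innermost
    factor \<open>1 / qpoch q q k\<close> of \<open>triple_sum_eq\<close>.\<close>
  have s1: "step (\<lambda>n. if n = 0 then 1 else 0) = (\<lambda>n. 1 / qpoch q q n)"
  proof
    fix n
    have "step (\<lambda>n. if n = 0 then 1 else 0) n = (\<Sum>k\<le>n. if k = 0 then 1 / qpoch q q n else 0)"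
      unfolding step_def by (rule sum.cong) auto
    thus "step (\<lambda>n. if n = 0 then 1 else 0) n = 1 / qpoch q q n" by simp
  qed
  define \<beta> where "\<beta> = step (step (\<lambda>n. 1 / qpoch q q n))"
  define \<alpha> where "\<alpha> = mul (mul (mul (unit_alpha a q)))"
  have p: "bailey_pair a q \<alpha> \<beta>"
    using pair[OF pair[OF pair[OF bailey_pair_unit[OF q(1) a]]]] unfolding s1 \<alpha>_def \<beta>_def .
  have "Bseq (\<lambda>n. inverse (qpoch q q n))"
    by (intro Bseq_inverse_qpoch power_Suc_neq_1 q(1))
  hence "Bseq \<beta>"
    unfolding \<beta>_def step_def by (intro Bseq_bailey_step q(1)) (simp add: inverse_eq_divide)
  hence s\<beta>: "summable (\<lambda>n. norm (a ^ n * q ^ (n\<^sup>2) * \<beta> n))"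
    by (rule summable_gaussian_Bseq[OF q(1)])
  have e: "a ^ n * q ^ (n\<^sup>2) * \<alpha> n = (a ^ 4) ^ n * (q ^ 4) ^ (n\<^sup>2) * unit_alpha a q n" for n
  proof -
    have "(x ^ 4) ^ m = x ^ m * x ^ m * x ^ m * x ^ m" for x :: complex and m
      by (simp add: numeral_eq_Suc power_mult_distrib)
    thus ?thesis by (simp only: \<alpha>_def mul_def mult_ac)
  qed
  have Q: "norm (q ^ 4) < 1" using q by (simp add: norm_power power_less_one_iff)
  have s\<alpha>: "summable (\<lambda>n. norm (a ^ n * q ^ (n\<^sup>2) * \<alpha> n))"
    unfolding e by (intro summable_gaussian_Bseq Q Bseq_unit_alpha q(1))
  show ?thesis
    unfolding triple_sum_eq[OF q(1)] e[symmetric]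
    using bailey_limit[OF q a p s\<alpha> s\<beta>] by (simp add: \<beta>_def step_def)
qed

text \<open>The two summability claims ensure that each \<open>suminf\<close> in the identity is the
  value of a convergent series and not a default.\<close>

theorem corollary2p6:
  fixes q a :: complex
  assumes "norm q < 1"
    and "\<And>i::nat. a * q ^ i \<noteq> 1"
  shows "(\<lambda>(r, s, t). norm
            (a ^ (r + 2 * s + 3 * t) * q ^ (3 * (r + s + t)\<^sup>2 + 3 * (s + t)\<^sup>2 + 3 * t\<^sup>2)
              / (qpoch (q ^ 3) (q ^ 3) r * qpoch (q ^ 3) (q ^ 3) s * qpoch (q ^ 3) (q ^ 3) t)))
          summable_on (UNIV :: (nat \<times> nat \<times> nat) set)
    \<and> summable (\<lambda>j. norm
            (a ^ j * q ^ (j\<^sup>2) * qpoch a (q ^ 3) j / (qpoch a q (2 * j) * qpoch q q j)))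
    \<and> (\<Sum>r. \<Sum>s. \<Sum>t.
            a ^ (r + 2 * s + 3 * t) * q ^ (3 * (r + s + t)\<^sup>2 + 3 * (s + t)\<^sup>2 + 3 * t\<^sup>2)
              / (qpoch (q ^ 3) (q ^ 3) r * qpoch (q ^ 3) (q ^ 3) s * qpoch (q ^ 3) (q ^ 3) t))
         = qpoch_inf (a * q) q / qpoch_inf (a * q ^ 3) (q ^ 3)
           * (\<Sum>j. a ^ j * q ^ (j\<^sup>2) * qpoch a (q ^ 3) j / (qpoch a q (2 * j) * qpoch q q j))"
proof -
  note q = assms(1) and a = assms(2)
  have Q: "norm (q ^ 3) < 1" using q by (simp add: norm_power power_less_one_iff)
  have aQ: "a * (q ^ 3) ^ i \<noteq> 1" for i using a[of "3 * i"] by (simp add: power_mult)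
  have aq: "a * q * q ^ i \<noteq> 1" for i using a[of "Suc i"] by (simp add: mult.assoc)
  have pw: "q ^ (3 * x + 3 * y + 3 * z) = (q ^ 3) ^ (x + y + z)" for x y z
    by (simp add: power_mult power_add)
  have eq: "(\<Sum>r. \<Sum>s. \<Sum>t. a ^ (r + 2 * s + 3 * t) * (q ^ 3) ^ ((r + s + t)\<^sup>2 + (s + t)\<^sup>2 + t\<^sup>2)
              / (qpoch (q ^ 3) (q ^ 3) r * qpoch (q ^ 3) (q ^ 3) s * qpoch (q ^ 3) (q ^ 3) t))
         = qpoch_inf (a * q) q / qpoch_inf (a * q ^ 3) (q ^ 3)
           * (\<Sum>j. a ^ j * q ^ (j\<^sup>2) * (qpoch a (q ^ 3) j / (qpoch a q (2 * j) * qpoch q q j)))"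
  \<comment> \<open>The Bailey argument divides by powers of \<open>q\<close>. At
    \<open>q = 0\<close> only the terms of index 0 survive, and both sides are 1.\<close>
  proof (cases "q = 0")
    case True
    have "(\<Sum>j. a ^ j * q ^ (j\<^sup>2) * (qpoch a (q ^ 3) j / (qpoch a q (2 * j) * qpoch q q j)))
        = (\<Sum>j\<in>{0}. a ^ j * q ^ (j\<^sup>2) * (qpoch a (q ^ 3) j / (qpoch a q (2 * j) * qpoch q q j)))"
      using True by (intro suminf_finite) auto
    moreover have "(\<Sum>r. \<Sum>s. \<Sum>t. a ^ (r + 2 * s + 3 * t) * (q ^ 3) ^ ((r + s + t)\<^sup>2 + (s + t)\<^sup>2 + t\<^sup>2)
              / (qpoch (q ^ 3) (q ^ 3) r * qpoch (q ^ 3) (q ^ 3) s * qpoch (q ^ 3) (q ^ 3) t))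
       = (\<Sum>r. \<Sum>s. \<Sum>t. if r = 0 \<and> s = 0 \<and> t = 0 then 1 else 0)"
      using True by (intro suminf_cong) (auto simp: power_0_left)
    moreover have "(\<Sum>t. if r = 0 \<and> s = 0 \<and> t = 0 then 1 else 0) = (if r = 0 \<and> s = 0 then 1 else 0 :: complex)"
      for r s :: nat
      by (subst suminf_finite[of "{0}"]) auto
    moreover have "(\<Sum>s. if r = 0 \<and> s = 0 then 1 else 0) = (if r = 0 then 1 else 0 :: complex)"
      for r :: nat
      by (subst suminf_finite[of "{0}"]) auto
    moreover have "(\<Sum>r. if r = 0 then 1 else 0) = (1 :: complex)"
      by (subst suminf_finite[of "{0::nat}"]) auto
    ultimately show ?thesis using True by (simp add: qpoch_inf_def)
  next
    case False
    \<comment> \<open>Both evaluations contain the same sum over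
      \<open>unit_alpha a (q ^ 3)\<close>; it is eliminated using that
      \<open>qpoch_inf (a * q) q\<close> is nonzero.\<close>
    show ?thesis
      using cubic_sum[OF q False a] triple_sum[OF Q _ aQ] False
        qpoch_inf_nonzero[OF q aq] by simp
  qed
  show ?thesis
    using abs_summable_triple[OF Q, of a] cubic_beta_summable[OF q a] eq
    unfolding pw by simp
qed

end
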